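(* Let $\{X_i\}_{i\ge 1}$ be i.i.d. random variables with continuous density $f$ and cumulative distribution function $F(y)=\mathbb{P}(X_1<y)=\int_0^y f(z)\,dz$. Let $\{n_t\}_{t\ge 1}$ be a strictly increasing sequence of positive integers with comparison sets $\mathcal{C}(n_t)\subseteq\{1,2,\ldots,n_t-1\}$ such that (i) $\mathcal{C}(n_1)\subsetneq \mathcal{C}(n_2)\subsetneq\cdots$ and (ii) $n_{t-1}\in\mathcal{C}(n_t)$ for all $t\ge 2$. Let $A_{n_t}=\{X_{n_t}>\max_{j\in\mathcal{C}(n_t)}X_j\}$ be the record event at index $n_t$ and let $c(n_t)=\#\mathcal{C}(n_t)+1$. Then for every integer $r\ge 1$, $$\mathbb{P}(A_{n_r})=\frac{1}{c(n_r)}.$$ Moreover, for any finite set of (distinct) indices $\{i_1,\ldots,i_k\}\subset\{n_t\}_{t\ge1}$, the record events $\{A_{i_j}\}_{1\le j\le k}$ are mutually independent in the sense that $$\mathbb{P}\left(A_{i_1}\cap A_{i_2}\cap\cdots\cap A_{i_k}\right)=\prod_{j=1}^k\mathbb{P}(A_{i_j})=\frac{1}{c(i_1)\,c(i_2)\cdots c(i_k)}.$$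
   Context: The formula for $F$ means that the random variables are supported on $[0,\infty)$. $\#S$ denotes the cardinality of a finite set $S$. If a comparison set is empty, the corresponding maximum is taken to be $-\infty$, so that the record event always occurs. *)

theory Defs
  imports "HOL-Probability.Probability"
begin

text \<open>
  The maximum is taken in the extended reals; inserting \<open>-\<infinity>\<close> leaves the maximum of a nonempty
  finite set of reals unchanged and makes the maximum over the empty set \<open>-\<infinity>\<close>.
\<close>

definition record_event ::
  "'a measure \<Rightarrow> (nat \<Rightarrow> 'a \<Rightarrow> real) \<Rightarrow> (nat \<Rightarrow> nat set) \<Rightarrow> nat \<Rightarrow> 'a set" where
  "record_event M X C m =
     {\<omega> \<in> space M. ereal (X m \<omega>) > Max (insert (-\<infinity>) ((\<lambda>j. ereal (X j \<omega>)) ` C m))}"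

definition comparison_count :: "(nat \<Rightarrow> nat set) \<Rightarrow> nat \<Rightarrow> nat" where
  "comparison_count C m = card (C m) + 1"

end

theory Submission
  imports Defs
begin

text \<open>
  The record indicators are independent because each of them is independent of \<^emph>\<open>how large\<close> the
  current maximum is. Let \<open>D\<close> be the common law, \<open>G y = D {..<y}\<close>, and call an event \<open>E\<close> that depends
  only on \<open>(X\<^sub>j)\<close> for \<open>j\<close> in a finite set \<open>A\<close> independent of the maximum over \<open>A\<close> if
  \<open>P (E \<inter> {X\<^sub>j < y for all j \<in> A}) = P E * G y ^ card A\<close> for every \<open>y\<close>.

  Suppose \<open>E\<close> has this property and a new index \<open>m \<notin> A\<close> arrives. Conditioning on \<open>X\<^sub>m = y\<close> shows
  that \<open>E\<close> together with a record at \<open>m\<close> and all values below \<open>x\<close> has probability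
  \<open>P E * \<integral> G y ^ card A\<close>, the integral being over \<open>y < x\<close> with respect to \<open>D\<close>. Since \<open>D\<close> has no
  atoms, \<open>G (X\<^sub>m)\<close> is uniformly distributed, and the integral is \<open>G x ^ (card A + 1) / (card A + 1)\<close>
  (\<open>nn_integral_power_emeasure_lessThan\<close>). Letting \<open>x\<close> grow gives the factor
  \<open>1 / (card A + 1)\<close>, and the formula itself says that \<open>E\<close> intersected with the record event is
  independent of the maximum over \<open>insert m A\<close> (\<open>indep_of_max_record\<close>). Adding indices that do not
  take part in \<open>E\<close> keeps the property (\<open>indep_of_max_mono\<close>).

  For \<open>s < t\<close> the event at \<open>n s\<close> involves only indices in \<open>C (n t)\<close>, because
  \<open>C (n s) \<subseteq> C (n t)\<close> and \<open>n s \<in> C (n (s + 1)) \<subseteq> C (n t)\<close>. Hence the step can be iterated along any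
  finite increasing selection of record times (\<open>prob_nested_records\<close>). The common density supplies
  the two properties of the \<open>X\<^sub>i\<close> used above: they have the same law, and this law has no atoms.
\<close>

section \<open>Powers of an atomless distribution function\<close>

lemma (in real_distribution) measurable_emeasure_lessThan [measurable]:
  "(\<lambda>y. emeasure M {..<y}) \<in> borel_measurable borel"
proof -
  have "mono (\<lambda>y. measure M {..<y})"
    by (auto intro!: monoI finite_measure_mono)
  then have "(\<lambda>y. ennreal (measure M {..<y})) \<in> borel_measurable borel"
    using borel_measurable_mono by measurable
  then show ?thesis
    by (simp add: emeasure_eq_measure)
qed

text \<open>
  This is the identity \<open>\<integral> G ^ k dG = G ^ (k + 1) / (k + 1)\<close>, valid for every continuous distribution
  function \<open>G\<close>. The induction step replaces integration by parts by Fubini: in \<open>G x * \<integral> G y ^ k\<close> the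
  factor \<open>G x\<close> splits into \<open>D {z. z < y}\<close> and \<open>D {z. y < z \<and> z < x}\<close>, the tie \<open>z = y\<close> having
  measure zero. The first part gives the integral of \<open>G ^ (k + 1)\<close>; exchanging the order of
  integration in the second part makes the inner integral the one of the induction hypothesis.
\<close>

lemma (in real_distribution) nn_integral_power_emeasure_lessThan:
  assumes atomless: "\<And>y. emeasure M {y} = 0"
  shows "of_nat (Suc k) * (\<integral>\<^sup>+y. emeasure M {..<y} ^ k * indicator {..<x} y \<partial>M) =
    emeasure M {..<x} ^ Suc k"
proof (induction k arbitrary: x)
  case 0
  show ?case by simp
next
  case (Suc k)
  let ?G = "\<lambda>y. emeasure M {..<y}"
  let ?a = "\<lambda>k x. \<integral>\<^sup>+y. ?G y ^ k * indicator {..<x} y \<partial>M"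
  interpret pair_sigma_finite M M ..
  have split: "?G x = ?G y + emeasure M {y<..<x}" if "y < x" for y
  proof -
    have eq: "{..<x} = {..<y} \<union> ({y} \<union> {y<..<x})" using that by (intro set_eqI) (simp, linarith)
    have "?G x = ?G y + emeasure M ({y} \<union> {y<..<x})"
      unfolding eq by (subst plus_emeasure) auto
    also have "emeasure M ({y} \<union> {y<..<x}) = emeasure M {y<..<x}"
      using plus_emeasure[of "{y}" M "{y<..<x}"] by (simp add: atomless)
    finally show ?thesis .
  qed
  have swap: "(\<integral>\<^sup>+y. ?G y ^ k * indicator {..<x} y * emeasure M {y<..<x} \<partial>M) =
      (\<integral>\<^sup>+z. ?a k z * indicator {..<x} z \<partial>M)"
  proof -
    have "(\<integral>\<^sup>+y. ?G y ^ k * indicator {..<x} y * emeasure M {y<..<x} \<partial>M) =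
        (\<integral>\<^sup>+y. (\<integral>\<^sup>+z. ?G y ^ k * (if y < z \<and> z < x then 1 else 0) \<partial>M) \<partial>M)"
    proof (intro nn_integral_cong)
      fix y
      have "(\<integral>\<^sup>+z. ?G y ^ k * (if y < z \<and> z < x then 1 else 0) \<partial>M) =
          (\<integral>\<^sup>+z. ?G y ^ k * indicator {y<..<x} z \<partial>M)"
        by (intro nn_integral_cong) (auto simp: indicator_def)
      also have "\<dots> = ?G y ^ k * emeasure M {y<..<x}"
        by (simp add: nn_integral_cmult_indicator)
      finally show "?G y ^ k * indicator {..<x} y * emeasure M {y<..<x} =
          (\<integral>\<^sup>+z. ?G y ^ k * (if y < z \<and> z < x then 1 else 0) \<partial>M)"
        by (cases "y < x") auto
    qed
    also have "\<dots> = (\<integral>\<^sup>+z. (\<integral>\<^sup>+y. ?G y ^ k * (if y < z \<and> z < x then 1 else 0) \<partial>M) \<partial>M)"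
      by (rule Fubini'[symmetric]) measurable
    also have "\<dots> = (\<integral>\<^sup>+z. ?a k z * indicator {..<x} z \<partial>M)"
    proof (intro nn_integral_cong)
      fix z
      show "(\<integral>\<^sup>+y. ?G y ^ k * (if y < z \<and> z < x then 1 else 0) \<partial>M) = ?a k z * indicator {..<x} z"
        by (cases "z < x") (auto intro!: nn_integral_cong simp: indicator_def)
    qed
    finally show ?thesis .
  qed
  have [measurable]: "?a k \<in> borel_measurable M"
  proof -
    have "(\<lambda>z. \<integral>\<^sup>+y. ?G y ^ k * (if y < z then 1 else 0) \<partial>M) \<in> borel_measurable M"
      by measurable
    then show ?thesis
      by (rule measurable_cong[THEN iffD1, rotated])
        (auto intro!: nn_integral_cong simp: indicator_def)
  qed
  have "?G x ^ Suc (Suc k) = of_nat (Suc k) * (?a k x * ?G x)"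
    by (simp only: power_Suc2[of _ "Suc k"] Suc.IH[symmetric] mult.assoc)
  also have "?a k x * ?G x = (\<integral>\<^sup>+y. ?G y ^ k * indicator {..<x} y * ?G x \<partial>M)"
    by (rule nn_integral_multc[symmetric]) measurable
  also have "\<dots> = (\<integral>\<^sup>+y. ?G y ^ Suc k * indicator {..<x} y +
      ?G y ^ k * indicator {..<x} y * emeasure M {y<..<x} \<partial>M)"
    by (intro nn_integral_cong)
      (auto simp: indicator_def split distrib_left mult.commute power_Suc2 simp del: power_Suc)
  also have "\<dots> = ?a (Suc k) x + (\<integral>\<^sup>+y. ?G y ^ k * indicator {..<x} y * emeasure M {y<..<x} \<partial>M)"
  proof (rule nn_integral_add)
    have "(\<lambda>y. emeasure M {y<..<x}) \<in> borel_measurable M"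
    proof -
      have "{p \<in> space (M \<Otimes>\<^sub>M M). fst p < snd p \<and> snd p < x} \<in> sets (M \<Otimes>\<^sub>M M)"
        by measurable
      from measurable_emeasure_Pair1[OF this] show ?thesis
        by (rule measurable_cong[THEN iffD1, rotated])
          (auto intro!: arg_cong[where f = "emeasure M"] simp: space_pair_measure)
    qed
    then show "(\<lambda>y. ?G y ^ k * indicator {..<x} y * emeasure M {y<..<x}) \<in> borel_measurable M"
      by measurable
  qed measurable
  also have "of_nat (Suc k) * (?a (Suc k) x +
      (\<integral>\<^sup>+y. ?G y ^ k * indicator {..<x} y * emeasure M {y<..<x} \<partial>M)) =
      of_nat (Suc k) * ?a (Suc k) x + (\<integral>\<^sup>+z. of_nat (Suc k) * (?a k z * indicator {..<x} z) \<partial>M)"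
    unfolding swap distrib_left
    by (subst nn_integral_cmult) simp_all
  also have "(\<integral>\<^sup>+z. of_nat (Suc k) * (?a k z * indicator {..<x} z) \<partial>M) = ?a (Suc k) x"
    by (simp only: mult.assoc[symmetric] Suc.IH)
  also have "of_nat (Suc k) * ?a (Suc k) x + ?a (Suc k) x = of_nat (Suc (Suc k)) * ?a (Suc k) x"
    by (simp add: distrib_right)
  finally show ?case by simp
qed

section \<open>Events independent of the maximum\<close>

locale atomless_iid = prob_space M + law: real_distribution D
  for M :: "'a measure" and D :: "real measure" +
  fixes X :: "'i \<Rightarrow> 'a \<Rightarrow> real" and N :: "'i set"
  assumes indep: "indep_vars (\<lambda>_. borel) X N"
    and distr_X: "\<And>i. i \<in> N \<Longrightarrow> distr M borel (X i) = D"
    and atomless: "\<And>y. emeasure D {y} = 0"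
begin

lemma measurable_X [measurable]: "i \<in> N \<Longrightarrow> X i \<in> borel_measurable M"
  using indep by (simp add: indep_vars_def)

text \<open>
  Integration over the value of one variable \<open>X m\<close> that is independent of the family \<open>(X i)\<close>,
  \<open>i \<in> A\<close>. Both ways of extending \<open>A\<close> by one index rest on this formula.
\<close>

lemma emeasure_conditioning:
  assumes A: "A \<subseteq> N" and m: "m \<in> N" "m \<notin> A"
    and P: "Measurable.pred (PiM A (\<lambda>_. borel) \<Otimes>\<^sub>M borel) (\<lambda>p. P (fst p) (snd p))"
  shows "emeasure M {\<omega> \<in> space M. P (\<lambda>i\<in>A. X i \<omega>) (X m \<omega>)} =
    (\<integral>\<^sup>+y. emeasure M {\<omega> \<in> space M. P (\<lambda>i\<in>A. X i \<omega>) y} \<partial>D)"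
proof -
  \<comment> \<open>Independence of two variables is formulated for a common codomain type, so \<open>X m\<close> is first
    treated as a family over the one-point index set \<open>{m}\<close>.\<close>
  let ?S = "PiM A (\<lambda>_. borel :: real measure)" and ?T = "PiM {m} (\<lambda>_. borel :: real measure)"
  let ?XA = "\<lambda>\<omega>. \<lambda>i\<in>A. X i \<omega>" and ?Xm = "\<lambda>\<omega>. \<lambda>i\<in>{m}. X i \<omega>"
  let ?Q = "{p \<in> space (?S \<Otimes>\<^sub>M borel). P (fst p) (snd p)}"
  let ?Q' = "{p \<in> space (?S \<Otimes>\<^sub>M ?T). P (fst p) (snd p m)}"
  let ?g = "\<lambda>y. emeasure M {\<omega> \<in> space M. P (?XA \<omega>) y}"
  have X [measurable]: "?XA \<in> M \<rightarrow>\<^sub>M ?S" "?Xm \<in> M \<rightarrow>\<^sub>M ?T" "X m \<in> borel_measurable M"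
    using A m by (auto intro!: measurable_restrict)
  have Q: "?Q \<in> sets (?S \<Otimes>\<^sub>M borel)"
    using P by measurable
  have "(\<lambda>p. (fst p, snd p m)) \<in> ?S \<Otimes>\<^sub>M ?T \<rightarrow>\<^sub>M ?S \<Otimes>\<^sub>M borel"
    by measurable
  from measurable_compose[OF this P] have Q': "?Q' \<in> sets (?S \<Otimes>\<^sub>M ?T)"
    by (simp add: Measurable.pred_def)
  have joint: "distr M (?S \<Otimes>\<^sub>M ?T) (\<lambda>\<omega>. (?XA \<omega>, ?Xm \<omega>)) = distr M ?S ?XA \<Otimes>\<^sub>M distr M ?T ?Xm"
    using indep_var_restrict[OF indep, of A "{m}"] A m
    unfolding indep_var_distribution_eq by simp
  interpret dA: prob_space "distr M ?S ?XA"
    by (rule prob_space_distr[OF X(1)])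
  interpret dm: prob_space "distr M ?T ?Xm"
    by (rule prob_space_distr[OF X(2)])
  interpret m: pair_sigma_finite "distr M ?S ?XA" "distr M ?T ?Xm" ..
  interpret d: pair_sigma_finite "distr M ?S ?XA" D ..
  have sets_D: "sets (distr M ?S ?XA \<Otimes>\<^sub>M D) = sets (?S \<Otimes>\<^sub>M borel)"
    by (intro sets_pair_measure_cong) auto
  have sets_T: "sets (distr M ?S ?XA \<Otimes>\<^sub>M distr M ?T ?Xm) = sets (?S \<Otimes>\<^sub>M ?T)"
    by (intro sets_pair_measure_cong) auto
  have slice: "emeasure (distr M ?S ?XA) ((\<lambda>v. (v, y)) -` ?Q) = ?g y" for y
    using X measurable_space[OF X(1)] sets_Pair2[OF Q, of y]
    by (subst emeasure_distr)
      (auto intro!: arg_cong[where f = "emeasure M"] simp: space_pair_measure)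
  have slice': "emeasure (distr M ?S ?XA) ((\<lambda>v. (v, w)) -` ?Q') = ?g (w m)" if "w \<in> space ?T" for w
    using X measurable_space[OF X(1)] sets_Pair2[OF Q', of w] that
    by (subst emeasure_distr)
      (auto intro!: arg_cong[where f = "emeasure M"] simp: space_pair_measure)
  have g [measurable]: "?g \<in> borel_measurable borel"
    using d.measurable_emeasure_Pair2[of ?Q] Q sets_D unfolding slice by simp
  have "emeasure M {\<omega> \<in> space M. P (?XA \<omega>) (X m \<omega>)} =
      emeasure (distr M (?S \<Otimes>\<^sub>M ?T) (\<lambda>\<omega>. (?XA \<omega>, ?Xm \<omega>))) ?Q'"
    using Q' X measurable_space[OF X(1)] measurable_space[OF X(2)]
    by (subst emeasure_distr) (auto intro!: arg_cong[where f = "emeasure M"] simp: space_pair_measure)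
  also have "\<dots> = (\<integral>\<^sup>+w. emeasure (distr M ?S ?XA) ((\<lambda>v. (v, w)) -` ?Q') \<partial>distr M ?T ?Xm)"
    unfolding joint using Q' sets_T by (intro m.emeasure_pair_measure_alt2) simp
  also have "\<dots> = (\<integral>\<^sup>+w. ?g (w m) \<partial>distr M ?T ?Xm)"
    by (intro nn_integral_cong slice') simp
  also have "\<dots> = (\<integral>\<^sup>+\<omega>. ?g (X m \<omega>) \<partial>M)"
    by (subst nn_integral_distr) simp_all
  also have "\<dots> = (\<integral>\<^sup>+y. ?g y \<partial>distr M borel (X m))"
    by (rule nn_integral_distr[symmetric]) simp_all
  finally show ?thesis
    using distr_X[OF m(1)] by simp
qed

definition all_below :: "'i set \<Rightarrow> real \<Rightarrow> 'a set" where
  "all_below A y = {\<omega> \<in> space M. \<forall>j\<in>A. X j \<omega> < y}"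

text \<open>
  The first conjunct is measurability of \<open>E\<close> with respect to the variables indexed by \<open>A\<close>. In the
  second one, \<open>emeasure D {..<y} ^ card A\<close> is the distribution function of the maximum over \<open>A\<close>
  at \<open>y\<close>, so that the equation factorises a joint probability. Written with \<open>all_below\<close> instead of a
  maximum it also covers \<open>A = {}\<close>.
\<close>

definition indep_of_max :: "'a set \<Rightarrow> 'i set \<Rightarrow> bool" where
  "indep_of_max E A \<longleftrightarrow>
    (\<exists>B \<in> sets (PiM A (\<lambda>_. borel)). E = {\<omega> \<in> space M. (\<lambda>i\<in>A. X i \<omega>) \<in> B}) \<and>
    (\<forall>y. emeasure M (E \<inter> all_below A y) = emeasure M E * emeasure D {..<y} ^ card A)"

lemma indep_of_max_space: "indep_of_max (space M) {}"
  unfolding indep_of_max_def all_below_def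
  by (auto intro!: bexI[of _ "space (PiM {} (\<lambda>_. borel))"] simp: space_PiM restrict_def)

text \<open>
  An event that depends on the variables in \<open>A\<close>, cut down by a condition on those in \<open>insert m A\<close>,
  depends on the latter. This propagates the first conjunct of \<open>indep_of_max\<close>.
\<close>

lemma determined_insert:
  assumes "B \<in> sets (PiM A (\<lambda>_. borel))"
    and "Measurable.pred (PiM (insert m A) (\<lambda>_. borel)) R"
  shows "\<exists>B' \<in> sets (PiM (insert m A) (\<lambda>_. borel)).
    {\<omega> \<in> space M. (\<lambda>i\<in>A. X i \<omega>) \<in> B \<and> R (\<lambda>i\<in>insert m A. X i \<omega>)} =
    {\<omega> \<in> space M. (\<lambda>i\<in>insert m A. X i \<omega>) \<in> B'}"
proof (intro bexI)
  let ?S = "PiM (insert m A) (\<lambda>_. borel :: real measure)"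
  let ?B' = "{v \<in> space ?S. restrict v A \<in> B \<and> R v}"
  have "(\<lambda>v. restrict v A) \<in> ?S \<rightarrow>\<^sub>M PiM A (\<lambda>_. borel)"
    by (rule measurable_restrict_subset) auto
  then show "?B' \<in> sets ?S"
    using assms by measurable
  show "{\<omega> \<in> space M. (\<lambda>i\<in>A. X i \<omega>) \<in> B \<and> R (\<lambda>i\<in>insert m A. X i \<omega>)} =
    {\<omega> \<in> space M. (\<lambda>i\<in>insert m A. X i \<omega>) \<in> ?B'}"
    by (auto simp: space_PiM restrict_restrict Int_absorb1 subset_insertI)
qed

text \<open>
  The new variable is independent of \<open>E\<close> and of the old ones; requiring that it lie below \<open>y\<close>
  multiplies both sides of the factorisation by \<open>emeasure D {..<y}\<close>.
\<close>

lemma indep_of_max_insert: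
  assumes E: "indep_of_max E A" and A: "finite A" "A \<subseteq> N" and m: "m \<in> N" "m \<notin> A"
  shows "indep_of_max E (insert m A)"
proof -
  from E obtain B where B [measurable]: "B \<in> sets (PiM A (\<lambda>_. borel))"
    and E_eq: "E = {\<omega> \<in> space M. (\<lambda>i\<in>A. X i \<omega>) \<in> B}"
    and Ey: "\<And>y. emeasure M (E \<inter> all_below A y) = emeasure M E * emeasure D {..<y} ^ card A"
    by (auto simp: indep_of_max_def)
  have "emeasure M (E \<inter> all_below (insert m A) x) =
      emeasure M E * emeasure D {..<x} ^ card (insert m A)" for x
  proof -
    have "E \<inter> all_below (insert m A) x =
        {\<omega> \<in> space M. (\<lambda>i\<in>A. X i \<omega>) \<in> B \<and> (\<forall>j\<in>A. (\<lambda>i\<in>A. X i \<omega>) j < x) \<and> X m \<omega> < x}"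
      by (auto simp: E_eq all_below_def)
    also have "emeasure M \<dots> = (\<integral>\<^sup>+y. emeasure M
        {\<omega> \<in> space M. (\<lambda>i\<in>A. X i \<omega>) \<in> B \<and> (\<forall>j\<in>A. (\<lambda>i\<in>A. X i \<omega>) j < x) \<and> y < x} \<partial>D)"
      using A by (intro emeasure_conditioning[OF A(2) m]) measurable
    also have "\<dots> = (\<integral>\<^sup>+y. emeasure M E * emeasure D {..<x} ^ card A * indicator {..<x} y \<partial>D)"
    proof (intro nn_integral_cong)
      fix y
      have "{\<omega> \<in> space M. (\<lambda>i\<in>A. X i \<omega>) \<in> B \<and> (\<forall>j\<in>A. (\<lambda>i\<in>A. X i \<omega>) j < x) \<and> y < x} =
          (if y < x then E \<inter> all_below A x else {})"
        by (auto simp: E_eq all_below_def)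
      then show "emeasure M
          {\<omega> \<in> space M. (\<lambda>i\<in>A. X i \<omega>) \<in> B \<and> (\<forall>j\<in>A. (\<lambda>i\<in>A. X i \<omega>) j < x) \<and> y < x} =
          emeasure M E * emeasure D {..<x} ^ card A * indicator {..<x} y"
        by (simp add: Ey)
    qed
    also have "\<dots> = emeasure M E * emeasure D {..<x} ^ card A * emeasure D {..<x}"
      by (rule nn_integral_cmult_indicator) simp
    also have "\<dots> = emeasure M E * emeasure D {..<x} ^ card (insert m A)"
      using A m by (simp add: mult_ac)
    finally show ?thesis .
  qed
  moreover have "\<exists>B' \<in> sets (PiM (insert m A) (\<lambda>_. borel)). E = {\<omega> \<in> space M. (\<lambda>i\<in>insert m A. X i \<omega>) \<in> B'}"
    using determined_insert[OF B, where m = m and R = "\<lambda>_. True"] by (simp add: E_eq)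
  ultimately show ?thesis
    by (simp add: indep_of_max_def)
qed

lemma indep_of_max_mono:
  assumes E: "indep_of_max E A" and "A \<subseteq> J" "finite J" "J \<subseteq> N"
  shows "indep_of_max E J"
proof -
  have A: "finite A" "A \<subseteq> N"
    using assms finite_subset by auto
  have "indep_of_max E (A \<union> K)" if "finite K" "K \<subseteq> N - A" for K
    using that
  proof (induction rule: finite_induct)
    case empty
    then show ?case using E by simp
  next
    case (insert m K)
    then have "indep_of_max E (insert m (A \<union> K))"
      using A by (intro indep_of_max_insert) auto
    then show ?case by simp
  qed
  from this[of "J - A"] show ?thesis
    using assms by (auto simp: Un_absorb1)
qed

text \<open>
  Let \<open>y\<close> tend to infinity: the events \<open>all_below A y\<close> exhaust the space because \<open>A\<close> is finite, and
  the distribution function tends to one.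
\<close>

lemma prob_eq_from_all_below:
  assumes E: "E \<in> sets M" and A: "finite A" "A \<subseteq> N"
    and scaled: "\<And>y. c * prob (E \<inter> all_below A y) = p * measure D {..<y} ^ k"
  shows "c * prob E = p"
proof -
  have sets: "all_below A y \<in> sets M" for y
  proof -
    have [measurable]: "j \<in> A \<Longrightarrow> X j \<in> borel_measurable M" for j
      using A by auto
    show ?thesis
      using A(1) unfolding all_below_def by measurable
  qed
  have "(\<lambda>t. prob (E \<inter> all_below A (real t))) \<longlonglongrightarrow> prob (\<Union>t. E \<inter> all_below A (real t))"
    using E sets by (intro finite_Lim_measure_incseq) (force simp: incseq_def all_below_def)+
  moreover have "(\<Union>t. E \<inter> all_below A (real t)) = E"
  proof (intro antisym subsetI)
    fix \<omega> assume \<omega>: "\<omega> \<in> E"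
    obtain t where t: "Max (insert 0 ((\<lambda>j. X j \<omega>) ` A)) < real t"
      using reals_Archimedean2 by blast
    then have "\<omega> \<in> all_below A (real t)"
      using A \<omega> sets.sets_into_space[OF E] by (auto simp: all_below_def)
    with \<omega> show "\<omega> \<in> (\<Union>t. E \<inter> all_below A (real t))" by auto
  qed auto
  ultimately have "(\<lambda>t. c * prob (E \<inter> all_below A (real t))) \<longlonglongrightarrow> c * prob E"
    by (auto intro: tendsto_intros)
  moreover have "(\<lambda>t. p * measure D {..<real t} ^ k) \<longlonglongrightarrow> p * 1 ^ k"
  proof (intro tendsto_intros)
    have "(\<lambda>t. measure D {..<real t}) \<longlonglongrightarrow> measure D (\<Union>t. {..<real t})"
      by (intro law.finite_Lim_measure_incseq) (auto simp: incseq_def)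
    also have "(\<Union>t. {..<real t}) = space D"
      using reals_Archimedean2 by auto
    finally show "(\<lambda>t. measure D {..<real t}) \<longlonglongrightarrow> 1" by (simp only: law.prob_space)
  qed
  ultimately show ?thesis
    unfolding scaled by (simp add: LIMSEQ_unique)
qed

section \<open>Record events\<close>

definition exceeds_all :: "'i set \<Rightarrow> 'i \<Rightarrow> 'a set" where
  "exceeds_all A m = {\<omega> \<in> space M. \<forall>j\<in>A. X j \<omega> < X m \<omega>}"

text \<open>
  The core of the argument. Given \<open>X m = y\<close> with \<open>y < x\<close>, the event on the left of the
  factorisation becomes \<open>E \<inter> all_below A y\<close>, whose probability is known by assumption; integrating
  it over \<open>y < x\<close> raises the exponent from \<open>card A\<close> to \<open>card A + 1\<close> at the price of the
  factor \<open>1 / (card A + 1)\<close>. One identity thus yields both the probability of the record and the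
  hypothesis needed for the next one.
\<close>

lemma indep_of_max_record:
  assumes E: "indep_of_max E A" and A: "finite A" "A \<subseteq> N" and m: "m \<in> N" "m \<notin> A"
  shows "indep_of_max (E \<inter> exceeds_all A m) (insert m A)"
    and "prob (E \<inter> exceeds_all A m) = prob E / real (Suc (card A))"
proof -
  from E obtain B where B [measurable]: "B \<in> sets (PiM A (\<lambda>_. borel))"
    and E_eq: "E = {\<omega> \<in> space M. (\<lambda>i\<in>A. X i \<omega>) \<in> B}"
    and Ey: "\<And>y. emeasure M (E \<inter> all_below A y) = emeasure M E * emeasure D {..<y} ^ card A"
    by (auto simp: indep_of_max_def)
  let ?k = "card A" and ?R = "E \<inter> exceeds_all A m"
  have scaled: "real (Suc ?k) * prob (?R \<inter> all_below (insert m A) x) =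
      prob E * measure D {..<x} ^ Suc ?k" for x
  proof -
    have "?R \<inter> all_below (insert m A) x =
        {\<omega> \<in> space M. (\<lambda>i\<in>A. X i \<omega>) \<in> B \<and> (\<forall>j\<in>A. (\<lambda>i\<in>A. X i \<omega>) j < X m \<omega>) \<and> X m \<omega> < x}"
      by (auto simp: E_eq all_below_def exceeds_all_def dest: less_trans)
    also have "emeasure M \<dots> = (\<integral>\<^sup>+y. emeasure M
        {\<omega> \<in> space M. (\<lambda>i\<in>A. X i \<omega>) \<in> B \<and> (\<forall>j\<in>A. (\<lambda>i\<in>A. X i \<omega>) j < y) \<and> y < x} \<partial>D)"
      using A by (intro emeasure_conditioning[OF A(2) m]) measurable
    also have "\<dots> = (\<integral>\<^sup>+y. emeasure M E * (emeasure D {..<y} ^ ?k * indicator {..<x} y) \<partial>D)"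
    proof (intro nn_integral_cong)
      fix y
      have "{\<omega> \<in> space M. (\<lambda>i\<in>A. X i \<omega>) \<in> B \<and> (\<forall>j\<in>A. (\<lambda>i\<in>A. X i \<omega>) j < y) \<and> y < x} =
          (if y < x then E \<inter> all_below A y else {})"
        by (auto simp: E_eq all_below_def)
      then show "emeasure M
          {\<omega> \<in> space M. (\<lambda>i\<in>A. X i \<omega>) \<in> B \<and> (\<forall>j\<in>A. (\<lambda>i\<in>A. X i \<omega>) j < y) \<and> y < x} =
          emeasure M E * (emeasure D {..<y} ^ ?k * indicator {..<x} y)"
        by (simp add: Ey)
    qed
    also have "\<dots> = emeasure M E * (\<integral>\<^sup>+y. emeasure D {..<y} ^ ?k * indicator {..<x} y \<partial>D)"
      by (rule nn_integral_cmult) measurable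
    finally have "of_nat (Suc ?k) * emeasure M (?R \<inter> all_below (insert m A) x) =
        emeasure M E * (of_nat (Suc ?k) * (\<integral>\<^sup>+y. emeasure D {..<y} ^ ?k * indicator {..<x} y \<partial>D))"
      by (simp only: mult_ac)
    also have "\<dots> = emeasure M E * emeasure D {..<x} ^ Suc ?k"
      by (simp only: law.nn_integral_power_emeasure_lessThan[OF atomless])
    finally show ?thesis
      unfolding emeasure_eq_measure law.emeasure_eq_measure ennreal_of_nat_eq_real_of_nat
      by (simp add: ennreal_mult[symmetric] ennreal_power del: power_Suc of_nat_Suc)
  qed
  \<comment> \<open>The record condition restated in terms of the restricted family, to apply \<open>determined_insert\<close>.\<close>
  have "(\<lambda>i\<in>A. X i \<omega>) \<in> B \<and> (\<forall>j\<in>A. X j \<omega> < X m \<omega>) \<longleftrightarrow> (\<lambda>i\<in>A. X i \<omega>) \<in> B \<and>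
     (\<forall>j\<in>A. (\<lambda>i\<in>insert m A. X i \<omega>) j < (\<lambda>i\<in>insert m A. X i \<omega>) m)" for \<omega>
    by auto
  then have "?R = {\<omega> \<in> space M. (\<lambda>i\<in>A. X i \<omega>) \<in> B \<and>
     (\<forall>j\<in>A. (\<lambda>i\<in>insert m A. X i \<omega>) j < (\<lambda>i\<in>insert m A. X i \<omega>) m)}"
    by (auto simp: E_eq exceeds_all_def)
  then have det: "\<exists>B' \<in> sets (PiM (insert m A) (\<lambda>_. borel)).
      ?R = {\<omega> \<in> space M. (\<lambda>i\<in>insert m A. X i \<omega>) \<in> B'}"
    using determined_insert[OF B, where m = m and R = "\<lambda>v. \<forall>j\<in>A. v j < v m"] A
    by (simp add: Measurable.pred_def)
  have "?R \<in> sets M"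
  proof -
    have "(\<lambda>\<omega>. \<lambda>i\<in>insert m A. X i \<omega>) \<in> M \<rightarrow>\<^sub>M PiM (insert m A) (\<lambda>_. borel)"
      using A m by (intro measurable_restrict) auto
    with det show ?thesis by auto
  qed
  from prob_eq_from_all_below[OF this _ _ scaled] A m
  have prob_R: "real (Suc ?k) * prob ?R = prob E" by auto
  then show "prob ?R = prob E / real (Suc ?k)" by (simp add: field_simps)
  have "prob (?R \<inter> all_below (insert m A) x) = prob ?R * measure D {..<x} ^ Suc ?k" for x
    using scaled[of x] unfolding prob_R[symmetric] by (simp del: of_nat_Suc)
  then show "indep_of_max ?R (insert m A)"
    using det A m unfolding indep_of_max_def emeasure_eq_measure law.emeasure_eq_measure
    by (simp add: ennreal_mult[symmetric] ennreal_power del: power_Suc)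
qed

text \<open>
  Induction on the largest element \<open>b\<close> of \<open>T\<close>. The earlier records involve only indices in \<open>C b\<close>, hence
  their intersection is independent of the maximum over \<open>C b\<close>, and \<open>indep_of_max_record\<close>
  contributes the factor for \<open>b\<close>. Intersecting with \<open>space M\<close> gives the correct
  event for \<open>T = {}\<close>, where the indexed intersection is the whole type.
\<close>

lemma prob_nested_records:
  fixes C :: "'t::linorder \<Rightarrow> 'i set" and m :: "'t \<Rightarrow> 'i"
  assumes "finite T"
    and "\<And>t. t \<in> T \<Longrightarrow> finite (C t) \<and> C t \<subseteq> N \<and> m t \<in> N \<and> m t \<notin> C t"
    and "\<And>s t. s \<in> T \<Longrightarrow> t \<in> T \<Longrightarrow> s < t \<Longrightarrow> insert (m s) (C s) \<subseteq> C t"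
  shows "prob (space M \<inter> (\<Inter>t\<in>T. exceeds_all (C t) (m t))) = (\<Prod>t\<in>T. 1 / real (Suc (card (C t))))"
proof -
  \<comment> \<open>Independence of the maximum is carried along for every sufficiently large \<open>J\<close>, since the
    induction step needs it for \<open>J = C b\<close>.\<close>
  have "indep_of_max (space M \<inter> (\<Inter>t\<in>T. exceeds_all (C t) (m t))) J \<and>
     prob (space M \<inter> (\<Inter>t\<in>T. exceeds_all (C t) (m t))) = (\<Prod>t\<in>T. 1 / real (Suc (card (C t))))"
    if "finite J" "J \<subseteq> N" "\<And>t. t \<in> T \<Longrightarrow> insert (m t) (C t) \<subseteq> J" for J
    using assms that
  proof (induction T arbitrary: J rule: finite_linorder_max_induct)
    case empty
    then show ?case
      using indep_of_max_mono[OF indep_of_max_space] by (simp add: prob_space)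
  next
    case (insert b T)
    let ?E = "space M \<inter> (\<Inter>t\<in>T. exceeds_all (C t) (m t))"
    have b: "finite (C b)" "C b \<subseteq> N" "m b \<in> N" "m b \<notin> C b"
      using insert.prems(1)[of b] by auto
    have E: "indep_of_max ?E (C b)" "prob ?E = (\<Prod>t\<in>T. 1 / real (Suc (card (C t))))"
    proof -
      have "indep_of_max ?E (C b) \<and> prob ?E = (\<Prod>t\<in>T. 1 / real (Suc (card (C t))))"
      proof (rule insert.IH)
        show "insert (m t) (C t) \<subseteq> C b" if "t \<in> T" for t
          using insert.prems(2)[of t b] insert.hyps(2) that by simp
      qed (use insert.prems(1,2) b in simp_all)
      then show "indep_of_max ?E (C b)" "prob ?E = (\<Prod>t\<in>T. 1 / real (Suc (card (C t))))"
        by auto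
    qed
    have eq: "space M \<inter> (\<Inter>t\<in>insert b T. exceeds_all (C t) (m t)) = ?E \<inter> exceeds_all (C b) (m b)"
      by auto
    have "insert (m b) (C b) \<subseteq> J" using insert.prems by blast
    then have "indep_of_max (?E \<inter> exceeds_all (C b) (m b)) J"
      using indep_of_max_mono[OF indep_of_max_record(1)[OF E(1) b]] insert.prems by blast
    moreover have "b \<notin> T" using insert.hyps by auto
    ultimately show ?case
      unfolding eq using indep_of_max_record(2)[OF E(1) b] E(2) insert.hyps by simp
  qed
  note all = this
  have "finite (\<Union>t\<in>T. insert (m t) (C t))" "(\<Union>t\<in>T. insert (m t) (C t)) \<subseteq> N"
    using assms(1,2) by auto
  from all[OF this] show ?thesis by blast
qed

end

lemma record_event_eq_exceeds_all:
  fixes C :: "nat \<Rightarrow> nat set"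
  assumes "finite (C m)"
  shows "record_event M X C m = {\<omega> \<in> space M. \<forall>j\<in>C m. X j \<omega> < X m \<omega>}"
  using assms unfolding record_event_def by auto

section \<open>Independence of records over nested comparison sets\<close>

theorem theorem1:
  fixes M :: "'a measure" and X :: "nat \<Rightarrow> 'a \<Rightarrow> real"
    and f F :: "real \<Rightarrow> real"
    and n :: "nat \<Rightarrow> nat" and C :: "nat \<Rightarrow> nat set"
  assumes "prob_space M"
    and "prob_space.indep_vars M (\<lambda>_. borel) X {1..}"
    and "\<And>i. i \<ge> 1 \<Longrightarrow> distributed M lborel (X i) (\<lambda>z. ennreal (f z))"
    and "\<And>z. f z \<ge> 0"
    and "continuous_on {0..} f"
    and "\<And>y. F y = measure M {\<omega> \<in> space M. X 1 \<omega> < y}"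
    and "\<And>y. F y = (LINT z:{0..y}|lborel. f z)"
    and "\<And>t. t \<ge> 1 \<Longrightarrow> n t \<ge> 1"
    and "strict_mono_on {1..} n"
    and "\<And>t. t \<ge> 1 \<Longrightarrow> C (n t) \<subseteq> {1..n t - 1}"
    and "\<And>t. t \<ge> 1 \<Longrightarrow> C (n t) \<subset> C (n (t + 1))"
    and "\<And>t. t \<ge> 2 \<Longrightarrow> n (t - 1) \<in> C (n t)"
  shows "(\<forall>r\<ge>1. measure M (record_event M X C (n r)) = 1 / real (comparison_count C (n r))) \<and>
    (\<forall>I. finite I \<and> I \<noteq> {} \<and> I \<subseteq> n ` {1..} \<longrightarrow>
       measure M (\<Inter>i\<in>I. record_event M X C i) = (\<Prod>i\<in>I. measure M (record_event M X C i)) \<and>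
       (\<Prod>i\<in>I. measure M (record_event M X C i)) = 1 / (\<Prod>i\<in>I. real (comparison_count C i)))"
proof -
  interpret prob_space M by fact
  let ?D = "density lborel (\<lambda>z. ennreal (f z))"
  have X: "X i \<in> borel_measurable M" "distr M borel (X i) = ?D" if "i \<ge> 1" for i
  proof -
    show "X i \<in> borel_measurable M"
      using assms(3)[OF that] by (simp add: distributed_def)
    have "distr M borel (X i) = distr M lborel (X i)"
      by (rule distr_cong) auto
    then show "distr M borel (X i) = ?D"
      using assms(3)[OF that] by (simp add: distributed_def)
  qed
  have f: "(\<lambda>z. ennreal (f z)) \<in> borel_measurable borel"
    using assms(3)[of 1] by (simp add: distributed_def)
  interpret D: prob_space ?D
    using prob_space_distr[OF X(1)[of 1]] X(2)[of 1] by simp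
  interpret atomless_iid M ?D X "{1..}"
  proof
    show "indep_vars (\<lambda>_. borel) X {1..}" by fact
    show "emeasure ?D {y} = 0" for y
    proof -
      have "AE z in lborel. z \<noteq> y"
        by (rule AE_lborel_singleton)
      then have "(\<integral>\<^sup>+z. ennreal (f z) * indicator {y} z \<partial>lborel) = (\<integral>\<^sup>+z. 0 \<partial>lborel :: real measure)"
        by (intro nn_integral_cong_AE) (auto simp: indicator_def)
      then show ?thesis
        using f by (simp add: emeasure_density)
    qed
  qed (use X in auto)
  have C: "finite (C (n t)) \<and> C (n t) \<subseteq> {1..} \<and> n t \<in> {1..} \<and> n t \<notin> C (n t)" if "t \<ge> 1" for t
  proof -
    have "C (n t) \<subseteq> {1..n t - 1}" "n t \<ge> 1" using assms(8,10) that by auto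
    then show ?thesis using finite_subset[of "C (n t)" "{1..n t - 1}"] by fastforce
  qed
  have C_mono: "C (n s) \<subseteq> C (n t)" if "1 \<le> s" "s \<le> t" for s t
    using that(2,1)
  proof (induction t rule: dec_induct)
    case (step t)
    then show ?case using assms(11)[of t] by auto
  qed simp
  have nested: "insert (n s) (C (n s)) \<subseteq> C (n t)" if "1 \<le> s" "s < t" for s t
    using C_mono[of s t] C_mono[of "Suc s" t] assms(12)[of "Suc s"] that by auto
  have inj: "inj_on n {1..}"
    using assms(9) by (rule strict_mono_on_imp_inj_on)
  have event: "record_event M X C (n t) = exceeds_all (C (n t)) (n t)" if "t \<ge> 1" for t
    using C[OF that] by (simp add: record_event_eq_exceeds_all exceeds_all_def)
  have prob_Inter: "measure M (\<Inter>i\<in>n ` T. record_event M X C i) =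
      (\<Prod>i\<in>n ` T. 1 / real (comparison_count C i))"
    if T: "finite T" "T \<noteq> {}" "T \<subseteq> {1..}" for T
  proof -
    have "(\<Inter>i\<in>n ` T. record_event M X C i) = space M \<inter> (\<Inter>t\<in>T. exceeds_all (C (n t)) (n t))"
    proof -
      have "(\<Inter>i\<in>n ` T. record_event M X C i) = (\<Inter>t\<in>T. exceeds_all (C (n t)) (n t))"
        using T(3) event by (auto simp: image_iff)
      also have "\<dots> \<subseteq> space M" using T(2) by (auto simp: exceeds_all_def)
      ultimately show ?thesis by auto
    qed
    also have "prob \<dots> = (\<Prod>t\<in>T. 1 / real (Suc (card (C (n t)))))"
    proof (rule prob_nested_records)
      fix s t assume "s \<in> T" "t \<in> T" "s < t"
      then show "insert (n s) (C (n s)) \<subseteq> C (n t)" using T(3) by (intro nested) auto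
    qed (use T C in auto)
    also have "\<dots> = (\<Prod>i\<in>n ` T. 1 / real (comparison_count C i))"
      using inj_on_subset[OF inj T(3)] by (simp add: prod.reindex comparison_count_def)
    finally show ?thesis .
  qed
  have single: "measure M (record_event M X C (n r)) = 1 / real (comparison_count C (n r))"
    if "r \<ge> 1" for r
    using prob_Inter[of "{r}"] that by simp
  show ?thesis
  proof (intro conjI allI impI)
    fix I assume "finite I \<and> I \<noteq> {} \<and> I \<subseteq> n ` {1..}"
    then obtain T where T: "T \<subseteq> {1..}" "finite T" "I = n ` T" "T \<noteq> {}"
      using finite_subset_image[of I n "{1..}"] by auto
    have prod: "(\<Prod>i\<in>I. measure M (record_event M X C i)) =
        (\<Prod>i\<in>I. 1 / real (comparison_count C i))"
      using T single by (intro prod.cong) auto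
    show "measure M (\<Inter>i\<in>I. record_event M X C i) = (\<Prod>i\<in>I. measure M (record_event M X C i))"
      unfolding prod using prob_Inter T by simp
    show "(\<Prod>i\<in>I. measure M (record_event M X C i)) = 1 / (\<Prod>i\<in>I. real (comparison_count C i))"
      unfolding prod by (simp add: prod_dividef)
  qed (use single in auto)
qed

end
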